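(* Let $E\subset\mathbb{R}^d$ be a nonempty compact set and let $\mathcal{W}(\mathbb{R}^d\setminus E)$ be any fixed Whitney cover of $\mathbb{R}^d\setminus E$. Then $$\underline{\dim}_S(E)=\liminf_{k\to\infty}\tfrac1k\log_2\#\mathcal{W}_k(\mathbb{R}^d\setminus E).$$
   Context: $E_r=\{x\in\mathbb{R}^d:\operatorname{dist}(x,E)<r\}$ and $\partial E_r=\{x\in\mathbb{R}^d:\operatorname{dist}(x,E)=r\}$ (the $r$-boundary of $E$); $\mathcal{H}^{d-1}$ is the $(d-1)$-dimensional Hausdorff measure. The lower spherical dimension of a compact set $E$ is $$\underline{\dim}_S(E)=\inf\Big\{\lambda\ge0:\liminf_{r\downarrow0}\frac{\mathcal{H}^{d-1}(\partial E_r)}{r^{d-1-\lambda}}=0\Big\}.$$ Whitney cover: for an open set $\Omega\subsetneq\mathbb{R}^d$, a Whitney cover $\mathcal{W}(\Omega)$ is a countable collection $\{B_i\}_{i\in I}$ of closed balls $B_i=B(x_i,r_i)$ with $x_i\in\Omega$, $r_i=\frac18\operatorname{dist}(x_i,\mathbb{R}^d\setminus\Omega)$, $\Omega=\bigcup_iB_i$, and $\sum_i\chi_{B_i}\le C$ for some constant $C\ge1$. For $k\in\mathbb{Z}$, $\mathcal{W}_k(\Omega)=\{B(x_i,r_i)\in\mathcal{W}(\Omega):2^{-k-1}<r_i\le2^{-k}\}$. *)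

theory Defs
  imports "HOL-Analysis.Analysis"
begin

text \<open>Hausdorff measures of integer dimension \<open>m\<close>, as outer measures and without a
  normalising constant. The empty set has weight \<open>0\<close> and a nonempty set has weight
  \<open>diameter U ^ m\<close>, so that (with \<open>0 ^ 0 = 1\<close>) the case \<open>m = 0\<close> is the counting measure.
  Boundedness is required because \<^const>\<open>diameter\<close> is meaningless on unbounded sets.\<close>

definition hausdorff_weight :: "nat \<Rightarrow> 'a::metric_space set \<Rightarrow> ennreal" where
  "hausdorff_weight m U = (if U = {} then 0 else ennreal (diameter U ^ m))"

definition hausdorff_premeasure :: "nat \<Rightarrow> real \<Rightarrow> 'a::metric_space set \<Rightarrow> ennreal" where
  "hausdorff_premeasure m \<delta> A =
     (INF U \<in> {U :: nat \<Rightarrow> 'a set.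
                 (\<forall>n. bounded (U n) \<and> diameter (U n) \<le> \<delta>) \<and> A \<subseteq> (\<Union>n. U n)}.
        \<Sum>n. hausdorff_weight m (U n))"

definition hausdorff_measure :: "nat \<Rightarrow> 'a::metric_space set \<Rightarrow> ennreal" where
  "hausdorff_measure m A = (SUP \<delta> \<in> {0<..}. hausdorff_premeasure m \<delta> A)"

definition parallel_boundary :: "'a::metric_space set \<Rightarrow> real \<Rightarrow> 'a set" where
  "parallel_boundary E r = {x. infdist x E = r}"

text \<open>The infimum is taken in the extended reals, so no convention for the infimum of an empty
  set of real numbers is involved.\<close>

definition lower_spherical_dim :: "'a::euclidean_space set \<Rightarrow> ereal" where
  "lower_spherical_dim E =
     Inf (ereal ` {s. 0 \<le> s \<and>
       Liminf (at_right 0)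
         (\<lambda>r. hausdorff_measure (DIM('a) - 1) (parallel_boundary E r)
               / ennreal (r powr (real DIM('a) - 1 - s))) = 0})"

text \<open>A Whitney cover is a family of closed balls \<open>cball (x i) (r i)\<close>, \<open>i \<in> I\<close>. The condition
  \<open>\<Omega> \<noteq> UNIV\<close> also excludes the degenerate value \<open>infdist y {} = 0\<close>.\<close>

definition whitney_cover ::
  "'a::euclidean_space set \<Rightarrow> 'i set \<Rightarrow> ('i \<Rightarrow> 'a) \<Rightarrow> ('i \<Rightarrow> real) \<Rightarrow> bool" where
  "whitney_cover \<Omega> I x r \<longleftrightarrow>
     open \<Omega> \<and> \<Omega> \<noteq> UNIV \<and> countable I \<and>
     (\<forall>i\<in>I. x i \<in> \<Omega> \<and> r i = infdist (x i) (- \<Omega>) / 8) \<and>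
     \<Omega> = (\<Union>i\<in>I. cball (x i) (r i)) \<and>
     (\<exists>C::real. C \<ge> 1 \<and>
        (\<forall>y. (\<Sum>\<^sub>\<infinity>i\<in>I. indicator (cball (x i) (r i)) y :: ennreal) \<le> ennreal C))"

definition whitney_level ::
  "'i set \<Rightarrow> ('i \<Rightarrow> 'a::euclidean_space) \<Rightarrow> ('i \<Rightarrow> real) \<Rightarrow> int \<Rightarrow> 'a set set" where
  "whitney_level I x r k =
     {cball (x i) (r i) | i. i \<in> I \<and> 2 powi (- k - 1) < r i \<and> r i \<le> 2 powi (- k)}"

end

theory Submission
  imports Defs
begin

text \<open>Write \<open>t = 2\<^sup>-\<^sup>k\<close>, \<open>n = d - 1\<close>, \<open>S r\<close> for the measure of the \<open>r\<close>-boundary and \<open>N k\<close> for the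
  number of cover balls of level \<open>k\<close>. Then \<open>S (5 t) \<le> C * N k * t ^ n\<close> and
  \<open>N k * t ^ n \<le> C * S q\<close> for \<open>t \<le> q \<le> 2 t\<close>, from which the equality of exponents is immediate.
  Upper bound: the level \<open>k\<close> balls cover the \<open>5 t\<close>-boundary, and in each of them that boundary splits
  into boundedly many pieces on which the direction to a nearest point of \<open>E\<close> is almost constant;
  such a piece is a Lipschitz graph over a coordinate hyperplane.
  Lower bound: between the centre of a level \<open>k\<close> ball and its nearest point in \<open>E\<close> the
  \<open>q\<close>-boundary separates two balls of radius \<open>t\<close>, so it has content at least \<open>c * t ^ n\<close> there, and
  these regions overlap boundedly often.\<close>

section \<open>Upper bound for the Hausdorff measure of an \<open>r\<close>-boundary\<close>

text \<open>A finite cover becomes a competitor in the infimum by padding it with empty sets, whose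
  weight is 0 even for \<open>m = 0\<close>.\<close>

lemma hausdorff_premeasure_le_card:
  fixes U :: "'j \<Rightarrow> 'a::metric_space set"
  assumes J: "finite J" and A: "A \<subseteq> (\<Union>j\<in>J. U j)"
    and D: "\<And>j y z. j \<in> J \<Longrightarrow> y \<in> U j \<Longrightarrow> z \<in> U j \<Longrightarrow> dist y z \<le> D"
    and D0: "0 \<le> D" "D \<le> \<delta>"
  shows "hausdorff_premeasure m \<delta> A \<le> ennreal (real (card J) * D ^ m)"
proof -
  obtain h where h: "bij_betw h {0..<card J} J"
    using ex_bij_betw_nat_finite[OF J] by blast
  define V where "V n = (if n < card J then U (h n) else {})" for n
  have hJ: "h n \<in> J" if "n < card J" for n
    using h that by (auto simp: bij_betw_def)
  have bV: "bounded (V n)" for n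
  proof (cases "n < card J \<and> U (h n) \<noteq> {}")
    case True
    then obtain y where "y \<in> U (h n)" by auto
    with True D[OF hJ] have "\<forall>z\<in>V n. dist y z \<le> D" by (auto simp: V_def)
    then show ?thesis unfolding bounded_def by blast
  qed (auto simp: V_def)
  have dV: "diameter (V n) \<le> D" for n
    unfolding diameter_def V_def using D[OF hJ] D0
    by (auto intro!: cSUP_least)
  have cov: "A \<subseteq> (\<Union>n. V n)"
  proof
    fix a assume "a \<in> A"
    then obtain j where "j \<in> J" "a \<in> U j" using A by auto
    moreover then obtain n where "n < card J" "h n = j"
      using h by (metis atLeastLessThan_iff bij_betw_iff_bijections)
    ultimately show "a \<in> (\<Union>n. V n)" by (auto simp: V_def intro!: exI[of _ n])
  qed
  have w: "hausdorff_weight m (V n) \<le> (if n < card J then ennreal (D ^ m) else 0)" for n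
    using dV[of n] bV[of n]
    by (auto simp: hausdorff_weight_def V_def intro!: ennreal_leI power_mono diameter_ge_0)
  have "hausdorff_premeasure m \<delta> A \<le> (\<Sum>n. hausdorff_weight m (V n))"
    unfolding hausdorff_premeasure_def
    using bV dV D0 cov by (intro INF_lower) (auto intro: order_trans)
  also have "\<dots> = (\<Sum>n<card J. hausdorff_weight m (V n))"
    by (intro suminf_finite) (auto simp: V_def hausdorff_weight_def)
  also have "\<dots> \<le> (\<Sum>n<card J. ennreal (D ^ m))"
    using w by (intro sum_mono) (metis lessThan_iff)
  also have "\<dots> = ennreal (real (card J) * D ^ m)"
    using D0 by (simp add: ennreal_mult ennreal_of_nat_eq_real_of_nat)
  finally show ?thesis .
qed

text \<open>The open ball of radius \<open>r\<close> about \<open>e\<close> contains no point at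
  distance \<open>r\<close> from \<open>E\<close>, so \<open>z\<close> is at least as far from
  \<open>e\<close> as \<open>y\<close> is. Expanding the squares leaves an error quadratic in
  \<open>z - y\<close>.\<close>

lemma inner_toward_parallel_boundary:
  fixes E :: "'a::euclidean_space set"
  assumes "infdist z E = r" "e \<in> E" "dist y e = r"
  shows "- (norm (z - y))\<^sup>2 \<le> 2 * ((y - e) \<bullet> (z - y))"
proof -
  have "r \<le> dist z e" using assms(1) infdist_le[OF assms(2), of z] by simp
  then have "norm (y - e) \<le> norm ((z - y) + (y - e))"
    using assms(3) by (simp add: dist_norm)
  then have "(norm (y - e))\<^sup>2 \<le> (norm ((z - y) + (y - e)))\<^sup>2"
    by (intro power_mono) auto
  then show ?thesis using dot_norm[of "z - y" "y - e"] by (simp only: inner_commute) argo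
qed

text \<open>A nearest-point ball of a boundary point contains no other boundary point in its interior.
  Applied at both ends of a short segment between boundary points with almost equal normals, this
  makes the segment almost orthogonal to the normals.\<close>

lemma abs_inner_normal_le:
  fixes E :: "'a::euclidean_space set"
  assumes r: "r > 0" and y: "infdist y E = r" "e \<in> E" "dist y e = r"
    and z: "infdist z E = r" "f \<in> E" "dist z f = r"
    and v: "norm ((1/r) *\<^sub>R (y - e) - v) \<le> \<epsilon>" "norm ((1/r) *\<^sub>R (z - f) - v) \<le> \<epsilon>"
    and yz: "norm (z - y) \<le> 2 * \<epsilon> * r"
  shows "\<bar>v \<bullet> (z - y)\<bar> \<le> 2 * \<epsilon> * norm (z - y)"
proof -
  \<comment> \<open>One-sided bound at one end of the segment; using it for both orders of
    \<open>y\<close> and \<open>z\<close> gives the absolute value.\<close>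
  have key: "- (2 * \<epsilon> * norm (z - y)) \<le> v \<bullet> (z - y)"
    if z: "infdist z E = r" and y: "e \<in> E" "dist y e = r"
    and v: "norm ((1/r) *\<^sub>R (y - e) - v) \<le> \<epsilon>" and yz: "norm (z - y) \<le> 2 * \<epsilon> * r"
    for y z e :: 'a
  proof -
    define u where "u = (1/r) *\<^sub>R (y - e)"
    \<comment> \<open>One \<open>\<epsilon>\<close> pays for this quadratic error, the other for
      replacing the exact normal \<open>u\<close> by \<open>v\<close>.\<close>
    have "(norm (z - y))\<^sup>2 \<le> 2 * \<epsilon> * r * norm (z - y)"
      using yz by (simp add: power2_eq_square mult_right_mono)
    with inner_toward_parallel_boundary[OF z y]
    have "- (\<epsilon> * r * norm (z - y)) \<le> (y - e) \<bullet> (z - y)" by linarith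
    then have "- (\<epsilon> * norm (z - y)) \<le> u \<bullet> (z - y)"
      using r by (simp add: u_def pos_le_divide_eq mult_ac)
    moreover have "\<bar>(u - v) \<bullet> (z - y)\<bar> \<le> \<epsilon> * norm (z - y)"
      using v Cauchy_Schwarz_ineq2[of "u - v" "z - y"]
      by (metis (no_types, lifting) dual_order.trans mult_right_mono norm_ge_zero u_def)
    ultimately show ?thesis by (simp add: inner_diff_left)
  qed
  have "v \<bullet> (y - z) = - (v \<bullet> (z - y))" by (simp add: inner_diff_right)
  then show ?thesis
    using key[OF z(1) y(2,3) v(1) yz] key[OF y(1) z(2,3) v(2)] yz
    by (simp add: norm_minus_commute)
qed

text \<open>This is the Lipschitz graph property over the hyperplane orthogonal to \<open>b\<close>:
  as \<open>v\<close> has a definite component along \<open>b\<close>, a vector almost orthogonal to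
  \<open>v\<close> cannot point mainly along \<open>b\<close>.\<close>

lemma norm_le_horizontal_part:
  fixes w v b :: "'a::euclidean_space"
  assumes b: "b \<in> Basis" and v: "norm v = 1" "1 / real DIM('a) \<le> \<bar>v \<bullet> b\<bar>"
    and vw: "\<bar>v \<bullet> w\<bar> \<le> norm w / (4 * real DIM('a))"
  shows "norm w \<le> (2 * real DIM('a) + 1) * (\<Sum>b'\<in>Basis - {b}. \<bar>w \<bullet> b'\<bar>)"
proof -
  define d where "d = real DIM('a)"
  have d: "d \<ge> 1" by (simp add: d_def DIM_positive Suc_leI)
  define w' where "w' = w - (w \<bullet> b) *\<^sub>R b"
  have "norm w' \<le> (\<Sum>b'\<in>Basis. \<bar>w' \<bullet> b'\<bar>)" by (rule norm_le_l1)
  also have "\<dots> = (\<Sum>b'\<in>Basis - {b}. \<bar>w \<bullet> b'\<bar>)"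
    using b by (intro sum.mono_neutral_cong_right)
      (auto simp: w'_def inner_diff_left inner_Basis split: if_splits)
  finally have w'le: "norm w' \<le> (\<Sum>b'\<in>Basis - {b}. \<bar>w \<bullet> b'\<bar>)" .
  define \<beta> where "\<beta> = \<bar>w \<bullet> b\<bar>"
  have weq: "w = w' + (w \<bullet> b) *\<^sub>R b" by (simp add: w'_def)
  have nw: "norm w \<le> norm w' + \<beta>"
    using b norm_triangle_ineq[of w' "(w \<bullet> b) *\<^sub>R b"] by (simp add: weq[symmetric] \<beta>_def)
  have "\<beta> * (1/d) \<le> \<beta> * \<bar>v \<bullet> b\<bar>"
    using v(2) by (intro mult_left_mono) (auto simp: \<beta>_def d_def)
  also have "\<dots> = \<bar>v \<bullet> w - v \<bullet> w'\<bar>"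
    by (simp add: w'_def \<beta>_def inner_diff_right abs_mult)
  also have "\<dots> \<le> norm w / (4 * d) + norm w'"
    using vw Cauchy_Schwarz_ineq2[of v w'] v(1) unfolding d_def by simp
  also have "\<dots> \<le> (norm w' + \<beta>) / (4 * d) + norm w'"
    using nw d by (intro add_right_mono divide_right_mono) auto
  \<comment> \<open>After multiplication by \<open>d\<close> the term \<open>\<beta> / 4\<close> can
    be absorbed on the left.\<close>
  finally have "\<beta> \<le> (norm w' + \<beta>) / 4 + d * norm w'"
    using d by (simp add: field_simps)
  moreover have "norm w' \<le> d * norm w'" using d by (simp add: mult_le_cancel_right1)
  moreover have "0 \<le> d * norm w'" using d by simp
  ultimately have "\<beta> \<le> 2 * d * norm w'" by (simp add: field_simps)
  then have "norm w \<le> (2 * d + 1) * norm w'" using nw by (simp add: algebra_simps)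
  also have "\<dots> \<le> (2 * d + 1) * (\<Sum>b'\<in>Basis - {b}. \<bar>w \<bullet> b'\<bar>)"
    using w'le d by (intro mult_left_mono) auto
  finally show ?thesis by (simp add: d_def)
qed

lemma unit_vector_large_component:
  fixes v :: "'a::euclidean_space"
  assumes "norm v = 1"
  shows "\<exists>b\<in>Basis. 1 / real DIM('a) \<le> \<bar>v \<bullet> b\<bar>"
proof (rule ccontr)
  assume "\<not> ?thesis"
  then have "(\<Sum>b\<in>Basis. \<bar>v \<bullet> b\<bar>) < (\<Sum>b\<in>(Basis :: 'a set). 1 / real DIM('a))"
    by (intro sum_strict_mono) (auto simp: not_le)
  also have "\<dots> = 1" by simp
  finally show False using norm_le_l1[of v] assms by simp
qed

lemma abs_diff_le_of_floor_eq:
  fixes p q s :: real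
  assumes "s > 0" "\<lfloor>p / s\<rfloor> = \<lfloor>q / s\<rfloor>"
  shows "\<bar>p - q\<bar> \<le> s"
proof -
  have "\<bar>p / s - q / s\<bar> \<le> 1" using assms(2) by linarith
  then have "\<bar>p - q\<bar> / s \<le> 1" using assms(1) by (simp add: diff_divide_distrib[symmetric] abs_divide)
  then show ?thesis using assms(1) by simp
qed

text \<open>The pieces are indexed by a centre in \<open>P\<close>, a net element and a grid cell of
  side \<open>r / m\<close> in \<open>n\<close> of the coordinates. There are at most a constant
  times \<open>card P * m ^ n\<close> of them, each of diameter at most a constant times
  \<open>r / m\<close>, so the total weight stays bounded as \<open>m\<close> grows.
  \<open>K\<close> does not depend on \<open>E\<close>, \<open>r\<close> and \<open>P\<close>
  because the net lives at unit scale.\<close>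

lemma hausdorff_measure_parallel_boundary_le:
  obtains K :: real where "K > 0"
    "\<And>(E :: 'a::euclidean_space set) r P. compact E \<Longrightarrow> E \<noteq> {} \<Longrightarrow> r > 0 \<Longrightarrow> finite P \<Longrightarrow>
       parallel_boundary E r \<subseteq> (\<Union>p\<in>P. cball p r) \<Longrightarrow>
       hausdorff_measure (DIM('a) - 1) (parallel_boundary E r)
         \<le> ennreal (K * real (card P) * r ^ (DIM('a) - 1))"
proof -
  define n where "n = DIM('a) - 1"
  define d where "d = real DIM('a)"
  have d: "d \<ge> 1" by (simp add: d_def DIM_positive Suc_leI)
  \<comment> \<open>Chosen so that \<open>2 * \<epsilon>\<close> is the tolerance
    \<open>1 / (4 * d)\<close> of \<open>norm_le_horizontal_part\<close>.\<close>
  define \<epsilon> where "\<epsilon> = 1 / (8 * d)"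
  have \<epsilon>: "\<epsilon> > 0" using d by (simp add: \<epsilon>_def)
  \<comment> \<open>The first factor holds the unit normals, the second the positions relative to a
    centre, rescaled by \<open>1 / r\<close>; the finite net \<open>Q\<close> discretises both at
    once.\<close>
  define C where "C = (sphere 0 1 :: 'a set) \<times> (cball 0 1 :: 'a set)"
  have "compact C" unfolding C_def by (intro compact_Times compact_sphere compact_cball)
  then obtain Q where Q: "Q \<subseteq> C" "finite Q" "C \<subseteq> (\<Union>q\<in>Q. ball q \<epsilon>)"
    by (rule compactE_image[of C C "\<lambda>q. ball q \<epsilon>"]) (use \<epsilon> in auto)
  have "\<forall>q\<in>Q. \<exists>b\<in>Basis. 1 / d \<le> \<bar>fst q \<bullet> b\<bar>"
    using Q(1) unit_vector_large_component by (fastforce simp: C_def d_def)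
  then obtain \<beta> where \<beta>: "\<And>q. q \<in> Q \<Longrightarrow> \<beta> q \<in> Basis \<and> 1 / d \<le> \<bar>fst q \<bullet> \<beta> q\<bar>" by metis
  define L where "L = (2 * d + 1) * d"
  have L: "L > 0" using d by (simp add: L_def)
  \<comment> \<open>The summand 1 gives positivity whatever \<open>Q\<close> is; the factor 3 comes
    from \<open>2 * m + 1 \<le> 3 * m\<close>.\<close>
  define K where "K = (real (card Q) + 1) * (3 * L) ^ n"
  show thesis
  proof (rule that)
    show "K > 0" using L by (simp add: K_def add_nonneg_pos)
  next
    fix E :: "'a set" and r :: real and P :: "'a set"
    assume E: "compact E" "E \<noteq> {}" and r: "r > 0" and P: "finite P"
      and cov: "parallel_boundary E r \<subseteq> (\<Union>p\<in>P. cball p r)"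
    have "\<exists>e\<in>E. infdist y E = dist y e" for y
      using infdist_attains_inf[OF compact_imp_closed[OF E(1)] E(2)] by metis
    then obtain e where e: "\<And>y. e y \<in> E" "\<And>y. infdist y E = dist y (e y)" by metis
    have premeas: "hausdorff_premeasure n \<delta> (parallel_boundary E r)
        \<le> ennreal (K * real (card P) * r ^ n)" if \<delta>: "\<delta> > 0" for \<delta>
    proof -
      \<comment> \<open>Makes the grid so fine that pieces of diameter \<open>L * (r / m)\<close>
        are admissible at scale \<open>\<delta>\<close>.\<close>
      obtain m :: nat where m: "m > 0" "L * r / \<delta> < real m"
        using reals_Archimedean2[of "L * r / \<delta>"] L r \<delta>
        by (metis divide_pos_pos less_trans mult_pos_pos of_nat_0_less_iff)
      define s where "s = r / real m"
      have s: "s > 0" using r m by (simp add: s_def)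
      define G where "G q = PiE (Basis - {\<beta> q}) (\<lambda>_. {- int m..int m})" for q :: "'a \<times> 'a"
      define J where "J = P \<times> (SIGMA q:Q. G q)"
      \<comment> \<open>The coordinate along \<open>\<beta> q\<close> is left free: on such a piece
        it is controlled by the other coordinates.\<close>
      define U where "U = (\<lambda>(p, q, g). {y. infdist y E = r \<and>
         norm ((1/r) *\<^sub>R (y - e y) - fst q) \<le> \<epsilon> \<and> norm ((1/r) *\<^sub>R (y - p) - snd q) \<le> \<epsilon> \<and>
         (\<forall>b\<in>Basis - {\<beta> q}. \<lfloor>((y - p) \<bullet> b) / s\<rfloor> = g b)})"
      have finG: "finite (G q)" for q unfolding G_def by (intro finite_PiE) auto
      have cardG: "card (G q) = (2 * m + 1) ^ n" if "q \<in> Q" for q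
      proof -
        have "card (Basis - {\<beta> q}) = n" using \<beta>[OF that] by (simp add: n_def)
        moreover have "card {- int m..int m} = 2 * m + 1" by simp
        ultimately show ?thesis by (simp add: G_def card_PiE)
      qed
      have finJ: "finite J" unfolding J_def using P Q(2) finG by auto
      have cardJ: "card J = card P * (card Q * (2 * m + 1) ^ n)"
        using Q(2) finG cardG by (simp add: J_def card_cartesian_product)
      have sub: "parallel_boundary E r \<subseteq> (\<Union>j\<in>J. U j)"
      proof
        fix y assume y: "y \<in> parallel_boundary E r"
        then have yr: "infdist y E = r" by (simp add: parallel_boundary_def)
        obtain p where p: "p \<in> P" "dist p y \<le> r" using cov y by auto
        have ny: "norm (y - e y) = r" using e(2)[of y] yr by (simp add: dist_norm)
        have py: "norm (y - p) \<le> r" using p(2) by (simp add: dist_norm norm_minus_commute)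
        have "((1/r) *\<^sub>R (y - e y), (1/r) *\<^sub>R (y - p)) \<in> C"
          using ny py r by (simp add: C_def)
        then obtain q where q: "q \<in> Q"
          "dist q ((1/r) *\<^sub>R (y - e y), (1/r) *\<^sub>R (y - p)) < \<epsilon>"
          using Q(3) by auto
        have q1: "norm ((1/r) *\<^sub>R (y - e y) - fst q) \<le> \<epsilon>"
          using q(2) dist_fst_le[of q "((1/r) *\<^sub>R (y - e y), (1/r) *\<^sub>R (y - p))"]
          by (simp add: dist_norm norm_minus_commute)
        have q2: "norm ((1/r) *\<^sub>R (y - p) - snd q) \<le> \<epsilon>"
          using q(2) dist_snd_le[of q "((1/r) *\<^sub>R (y - e y), (1/r) *\<^sub>R (y - p))"]
          by (simp add: dist_norm norm_minus_commute)
        define g where "g = (\<lambda>b\<in>Basis - {\<beta> q}. \<lfloor>((y - p) \<bullet> b) / s\<rfloor>)"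
        have "\<lfloor>((y - p) \<bullet> b) / s\<rfloor> \<in> {- int m..int m}" if "b \<in> Basis" for b
        proof -
          have "\<bar>(y - p) \<bullet> b\<bar> \<le> r" using Basis_le_norm[OF that, of "y - p"] py by linarith
          then have "\<bar>((y - p) \<bullet> b) / s\<bar> \<le> real m"
            using s r m by (simp add: s_def abs_mult field_simps)
          then have "- real m \<le> ((y - p) \<bullet> b) / s" "((y - p) \<bullet> b) / s \<le> real m" by linarith+
          then show ?thesis by (simp add: le_floor_iff floor_le_iff)
        qed
        then have "g \<in> G q" by (auto simp: G_def g_def)
        then have "(p, q, g) \<in> J" using p q by (simp add: J_def)
        moreover have "y \<in> U (p, q, g)" using yr q1 q2 by (simp add: U_def g_def)
        ultimately show "y \<in> (\<Union>j\<in>J. U j)" by blast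
      qed
      have small: "dist y z \<le> L * s" if j: "j \<in> J" and y: "y \<in> U j" and z: "z \<in> U j" for j y z
      proof -
        obtain p q g where j': "j = (p, q, g)" by (cases j)
        have qQ: "q \<in> Q" using j j' by (simp add: J_def)
        then have nq: "norm (fst q) = 1" using Q(1) by (auto simp: C_def)
        have y': "infdist y E = r" "norm ((1/r) *\<^sub>R (y - e y) - fst q) \<le> \<epsilon>"
          "norm ((1/r) *\<^sub>R (y - p) - snd q) \<le> \<epsilon>"
          "\<And>b. b \<in> Basis - {\<beta> q} \<Longrightarrow> \<lfloor>((y - p) \<bullet> b) / s\<rfloor> = g b"
          using y j' by (auto simp: U_def)
        have z': "infdist z E = r" "norm ((1/r) *\<^sub>R (z - e z) - fst q) \<le> \<epsilon>"
          "norm ((1/r) *\<^sub>R (z - p) - snd q) \<le> \<epsilon>"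
          "\<And>b. b \<in> Basis - {\<beta> q} \<Longrightarrow> \<lfloor>((z - p) \<bullet> b) / s\<rfloor> = g b"
          using z j' by (auto simp: U_def)
        \<comment> \<open>Closeness to the same \<open>snd q\<close> supplies the short-segment
          hypothesis of \<open>abs_inner_normal_le\<close>.\<close>
        have "norm (((1/r) *\<^sub>R (z - p) - snd q) - ((1/r) *\<^sub>R (y - p) - snd q)) \<le> \<epsilon> + \<epsilon>"
          using norm_triangle_le_diff y'(3) z'(3) by (metis add_mono)
        also have "((1/r) *\<^sub>R (z - p) - snd q) - ((1/r) *\<^sub>R (y - p) - snd q) = (1/r) *\<^sub>R (z - y)"
          by (simp add: algebra_simps)
        also have "norm ((1/r) *\<^sub>R (z - y)) = norm (z - y) / r" using r by simp
        finally have zy: "norm (z - y) \<le> 2 * \<epsilon> * r"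
          using r by (simp add: pos_divide_le_eq)
        have "\<bar>fst q \<bullet> (z - y)\<bar> \<le> 2 * \<epsilon> * norm (z - y)"
          using abs_inner_normal_le[OF r y'(1) e(1) _ z'(1) e(1) _ y'(2) z'(2) zy] e(2) y'(1) z'(1)
          by simp
        also have "\<dots> = norm (z - y) / (4 * d)" by (simp add: \<epsilon>_def)
        finally have "norm (z - y) \<le> (2 * d + 1) * (\<Sum>b\<in>Basis - {\<beta> q}. \<bar>(z - y) \<bullet> b\<bar>)"
          using norm_le_horizontal_part[of "\<beta> q" "fst q" "z - y"] \<beta>[OF qQ] nq by (simp add: d_def)
        also have "\<dots> \<le> (2 * d + 1) * (\<Sum>b\<in>(Basis :: 'a set). s)"
        proof (rule mult_left_mono)
          have "\<bar>(z - y) \<bullet> b\<bar> \<le> s" if b: "b \<in> Basis - {\<beta> q}" for b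
            using abs_diff_le_of_floor_eq[OF s, of "(z - p) \<bullet> b" "(y - p) \<bullet> b"] y'(4)[OF b] z'(4)[OF b]
            by (simp add: inner_diff_left)
          then have "(\<Sum>b\<in>Basis - {\<beta> q}. \<bar>(z - y) \<bullet> b\<bar>) \<le> (\<Sum>b\<in>Basis - {\<beta> q}. s)"
            by (rule sum_mono)
          also have "\<dots> \<le> (\<Sum>b\<in>(Basis :: 'a set). s)" using s by (intro sum_mono2) auto
          finally show "(\<Sum>b\<in>Basis - {\<beta> q}. \<bar>(z - y) \<bullet> b\<bar>) \<le> (\<Sum>b\<in>(Basis :: 'a set). s)" .
        qed (use d in auto)
        also have "\<dots> = L * s" by (simp add: L_def d_def)
        finally show ?thesis by (simp add: dist_norm norm_minus_commute)
      qed
      have "L * s \<le> \<delta>" using m \<delta> by (simp add: s_def field_simps)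
      then have "hausdorff_premeasure n \<delta> (parallel_boundary E r)
          \<le> ennreal (real (card J) * (L * s) ^ n)"
        using hausdorff_premeasure_le_card[OF finJ sub small] L s by simp
      also have "real (card J) * (L * s) ^ n \<le> K * real (card P) * r ^ n"
      proof -
        \<comment> \<open>Cells per direction times diameter: \<open>m\<close> cancels, which makes
          the final bound independent of \<open>\<delta>\<close>.\<close>
        have "(2 * real m + 1) * (L * s) \<le> (3 * real m) * (L * s)"
          using m L s by (intro mult_right_mono) auto
        also have "\<dots> = 3 * L * r" using m by (simp add: s_def)
        finally have base: "(2 * real m + 1) * (L * s) \<le> 3 * L * r" .
        have "real (card J) * (L * s) ^ n
            = real (card P) * real (card Q) * ((2 * real m + 1) * (L * s)) ^ n"
          by (simp add: cardJ power_mult_distrib add.commute)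
        also have "\<dots> \<le> real (card P) * (real (card Q) + 1) * (3 * L * r) ^ n"
          using L s by (intro mult_mono[OF mult_left_mono power_mono[OF base]]) auto
        also have "\<dots> = K * real (card P) * r ^ n"
          by (simp add: K_def power_mult_distrib)
        finally show ?thesis .
      qed
      finally show ?thesis by (simp add: ennreal_leI)
    qed
    then show "hausdorff_measure (DIM('a) - 1) (parallel_boundary E r)
         \<le> ennreal (K * real (card P) * r ^ (DIM('a) - 1))"
      unfolding hausdorff_measure_def n_def[symmetric] by (intro SUP_least) auto
  qed
qed

section \<open>Lower bound: packing of balls and separation along axis-parallel paths\<close>

text \<open>Compare volumes: the balls have radius at least \<open>t / 2\<close>, lie in the ball of
  radius \<open>(R + 1) * t\<close> about \<open>y\<close>, and cover it at most \<open>C\<close>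
  times.\<close>

lemma card_le_of_bounded_overlap:
  fixes x :: "'i \<Rightarrow> 'a::euclidean_space"
  assumes J: "finite J" and C: "C \<ge> 0" and t: "t > 0" and R: "R \<ge> 0"
    and overlap: "\<And>y. (\<Sum>i\<in>J. indicator (cball (x i) (r i)) y :: ennreal) \<le> ennreal C"
    and r: "\<And>i. i \<in> J \<Longrightarrow> t / 2 \<le> r i \<and> r i \<le> t"
    and near: "\<And>i. i \<in> J \<Longrightarrow> dist y (x i) \<le> R * t"
  shows "real (card J) \<le> C * (2 * (R + 1)) ^ DIM('a)"
proof -
  define v where "v = unit_ball_vol (real DIM('a))"
  have v: "v > 0" by (simp add: v_def)
  define \<rho> where "\<rho> = (R + 1) * t"
  have \<rho>: "\<rho> \<ge> 0" using R t by (simp add: \<rho>_def)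
  have sub: "cball (x i) (r i) \<subseteq> cball y \<rho>" if "i \<in> J" for i
  proof
    fix z assume "z \<in> cball (x i) (r i)"
    then have "dist y z \<le> R * t + t"
      using near[OF that] r[OF that] dist_triangle[of y z "x i"] by simp
    then show "z \<in> cball y \<rho>" by (simp add: \<rho>_def algebra_simps)
  qed
  have "ennreal (real (card J) * (v * (t / 2) ^ DIM('a))) = (\<Sum>i\<in>J. ennreal (v * (t / 2) ^ DIM('a)))"
    using v t by (simp add: ennreal_mult ennreal_of_nat_eq_real_of_nat)
  also have "\<dots> \<le> (\<Sum>i\<in>J. emeasure lborel (cball (x i) (r i)))"
  proof (rule sum_mono)
    fix i assume i: "i \<in> J"
    then have "0 \<le> r i" using r[OF i] t by linarith
    then show "ennreal (v * (t / 2) ^ DIM('a)) \<le> emeasure lborel (cball (x i) (r i))"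
      using r[OF i] v t by (auto simp: emeasure_cball v_def intro!: ennreal_leI mult_left_mono power_mono)
  qed
  also have "\<dots> = (\<integral>\<^sup>+z. (\<Sum>i\<in>J. indicator (cball (x i) (r i)) z) \<partial>lborel)"
    by (subst nn_integral_sum) (auto intro!: borel_measurable_indicator)
  also have "\<dots> \<le> (\<integral>\<^sup>+z. ennreal C * indicator (cball y \<rho>) z \<partial>lborel)"
  proof (rule nn_integral_mono)
    fix z
    show "(\<Sum>i\<in>J. indicator (cball (x i) (r i)) z) \<le> ennreal C * indicator (cball y \<rho>) z"
    proof (cases "z \<in> cball y \<rho>")
      case True
      then show ?thesis using overlap[of z] by simp
    next
      case False
      then have "z \<notin> cball (x i) (r i)" if "i \<in> J" for i using sub[OF that] by blast
      then show ?thesis by (simp add: indicator_def)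
    qed
  qed
  also have "\<dots> = ennreal (C * (v * \<rho> ^ DIM('a)))"
    using C v \<rho> by (simp add: nn_integral_cmult_indicator emeasure_cball v_def ennreal_mult)
  finally have "real (card J) * (v * (t / 2) ^ DIM('a)) \<le> C * (v * \<rho> ^ DIM('a))"
    using C v \<rho> by (subst (asm) ennreal_le_iff) auto
  also have "C * (v * \<rho> ^ DIM('a)) = C * (2 * (R + 1)) ^ DIM('a) * (v * (t / 2) ^ DIM('a))"
    unfolding \<rho>_def power_mult_distrib power_divide by simp
  finally show ?thesis using v t by simp
qed

lemma emeasure_lborel_coordinate_box:
  fixes c :: "'a::euclidean_space"
  assumes "\<And>b. b \<in> Basis \<Longrightarrow> 0 \<le> g b"
  shows "{a. \<forall>b\<in>Basis. \<bar>a \<bullet> b - c \<bullet> b\<bar> \<le> g b} \<in> sets lborel" (is "?B \<in> _")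
    and "emeasure lborel {a. \<forall>b\<in>Basis. \<bar>a \<bullet> b - c \<bullet> b\<bar> \<le> g b} = ennreal (\<Prod>b\<in>Basis. 2 * g b)"
proof -
  define h where "h = (\<Sum>b\<in>Basis. g b *\<^sub>R b)"
  have h: "h \<bullet> b = g b" if "b \<in> Basis" for b using that by (simp add: h_def)
  have eq: "?B = cbox (c - h) (c + h)"
    by (fastforce simp: cbox_def inner_diff_left inner_add_left h abs_le_iff)
  then show "?B \<in> sets lborel" by simp
  have "emeasure lborel ?B = (\<Prod>b\<in>Basis. ((c + h) - (c - h)) \<bullet> b)"
    unfolding eq using assms by (subst emeasure_lborel_cbox)
      (auto simp: inner_diff_left inner_add_left h)
  also have "(\<Prod>b\<in>Basis. ((c + h) - (c - h)) \<bullet> b) = (\<Prod>b\<in>Basis. 2 * g b)"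
    by (intro prod.cong) (auto simp: inner_diff_left inner_add_left h)
  finally show "emeasure lborel ?B = ennreal (\<Prod>b\<in>Basis. 2 * g b)" .
qed

text \<open>The vertices of a polygonal path from 0 to \<open>w\<close> whose edges are parallel to
  the axes, taken in the order \<open>h\<close>.\<close>

definition axis_path :: "(nat \<Rightarrow> 'a::euclidean_space) \<Rightarrow> 'a \<Rightarrow> nat \<Rightarrow> 'a" where
  "axis_path h w j = (\<Sum>i<j. (w \<bullet> h i) *\<^sub>R h i)"

text \<open>Stop at the first vertex where the distance to \<open>E\<close> has reached
  \<open>r\<close> and apply the intermediate value theorem on the edge leading there. On that edge
  only the coordinate along \<open>h j\<close> varies.\<close>

lemma axis_path_crossing:
  fixes E :: "'a::euclidean_space set"
  assumes h: "bij_betw h {..<DIM('a)} Basis"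
    and a: "infdist a E < r" "r < infdist (a + w) E"
  shows "\<exists>j<DIM('a). \<exists>t\<in>{0..1}. a + axis_path h w j + (t * (w \<bullet> h j)) *\<^sub>R h j \<in> parallel_boundary E r"
proof -
  define P where "P j \<longleftrightarrow> r \<le> infdist (a + axis_path h w j) E" for j
  have "axis_path h w DIM('a) = (\<Sum>b\<in>Basis. (w \<bullet> b) *\<^sub>R b)"
    unfolding axis_path_def using h by (rule sum.reindex_bij_betw)
  then have "axis_path h w DIM('a) = w" by (simp add: euclidean_representation)
  then have PD: "P DIM('a)" using a by (simp add: P_def)
  have P0: "\<not> P 0" using a by (simp add: P_def axis_path_def)
  then obtain j where j: "j < DIM('a)" "\<not> P j" "P (Suc j)"
    using ex_least_nat_less[of P "DIM('a)"] PD by (auto simp: Suc_le_eq)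
  define f where "f t = infdist (a + axis_path h w j + (t * (w \<bullet> h j)) *\<^sub>R h j) E" for t :: real
  have "continuous_on {0..1} f" unfolding f_def by (intro continuous_intros)
  moreover have "f 0 \<le> r" using j by (simp add: f_def P_def)
  moreover have "r \<le> f 1" using j by (simp add: f_def P_def axis_path_def add.assoc)
  ultimately obtain t where "0 \<le> t" "t \<le> 1" "f t = r" using IVT'[of f 0 r 1] by auto
  then show ?thesis using j by (auto simp: f_def parallel_boundary_def intro!: exI[of _ j] bexI[of _ t])
qed

text \<open>Keeps the crossing points near the start of the path, so that only covering sets in a
  bounded region count.\<close>

lemma norm_axis_path_segment:
  fixes w :: "'a::euclidean_space"
  assumes h: "bij_betw h {..<DIM('a)} Basis" and j: "j < DIM('a)" and t: "t \<in> {0..1}"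
  shows "norm (axis_path h w j + (t * (w \<bullet> h j)) *\<^sub>R h j) \<le> real DIM('a) * norm w"
proof -
  have hB: "h i \<in> Basis" if "i < DIM('a)" for i using h that by (auto simp: bij_betw_def)
  have wh: "norm ((w \<bullet> h i) *\<^sub>R h i) \<le> norm w" if "i < DIM('a)" for i
    using hB[OF that] Basis_le_norm[of "h i" w] by simp
  have "norm ((t * (w \<bullet> h j)) *\<^sub>R h j) = \<bar>t\<bar> * norm ((w \<bullet> h j) *\<^sub>R h j)" by (simp add: abs_mult)
  also have "\<dots> \<le> 1 * norm w" using t wh[OF j] by (intro mult_mono) auto
  finally have "norm ((t * (w \<bullet> h j)) *\<^sub>R h j) \<le> norm w" by simp
  moreover have "norm (axis_path h w j) \<le> (\<Sum>i<j. norm w)"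
    unfolding axis_path_def using wh j by (intro sum_norm_le) auto
  ultimately have "norm (axis_path h w j + (t * (w \<bullet> h j)) *\<^sub>R h j) \<le> real (Suc j) * norm w"
    by (intro norm_triangle_le) (simp add: algebra_simps)
  also have "\<dots> \<le> real DIM('a) * norm w" using j by (intro mult_right_mono) auto
  finally show ?thesis .
qed

text \<open>Volume count behind the lower bound: every point of a ball inside the neighbourhood is moved
  to a ball outside it along segments parallel to the axes, so it lies in one of the boxes
  elongated in one axis direction that sit over the covering sets.\<close>

lemma hausdorff_content_between_balls:
  fixes E :: "'a::euclidean_space set" and U :: "nat \<Rightarrow> 'a set"
  assumes \<rho>: "\<rho> > 0" and inside: "\<And>a. a \<in> ball e \<rho> \<Longrightarrow> infdist a E < r"
    and outside: "\<And>a. a \<in> ball (e + w) \<rho> \<Longrightarrow> r < infdist a E"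
    and bU: "\<And>n. bounded (U n)" and cov: "parallel_boundary E r \<subseteq> (\<Union>n. U n)"
  shows "ennreal (unit_ball_vol DIM('a) * \<rho> ^ (DIM('a) - 1)) \<le>
    ennreal (real DIM('a) * 2 ^ DIM('a)) *
      (\<Sum>n. if U n \<inter> cball e (real DIM('a) * norm w + \<rho>) = {} then 0
           else hausdorff_weight (DIM('a) - 1) (U n))"
proof -
  define N where "N = DIM('a) - 1"
  have DN: "DIM('a) = Suc N" by (simp add: N_def DIM_positive)
  define v where "v = unit_ball_vol (real DIM('a))"
  have v: "v > 0" by (simp add: v_def)
  obtain h :: "nat \<Rightarrow> 'a" where h: "bij_betw h {..<DIM('a)} Basis"
    using ex_bij_betw_nat_finite[of "Basis :: 'a set"] by (auto simp: lessThan_atLeast0)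
  have hB: "h i \<in> Basis" if "i < DIM('a)" for i using h that by (auto simp: bij_betw_def)
  define meets where "meets n \<longleftrightarrow> U n \<inter> cball e (real DIM('a) * norm w + \<rho>) \<noteq> {}" for n
  define D where "D n = diameter (U n)" for n
  have D0: "D n \<ge> 0" for n unfolding D_def by (rule diameter_ge_0[OF bU])
  have "\<forall>n. \<exists>u. meets n \<longrightarrow> u \<in> U n" by (auto simp: meets_def)
  then obtain u where u: "\<And>n. meets n \<Longrightarrow> u n \<in> U n" by metis
  \<comment> \<open>The centre does not depend on the moving point: along \<open>h j\<close> the
    starting ball around \<open>e\<close> confines it, and in the other coordinates the crossing is
    a translate by the fixed vector \<open>axis_path h w j\<close>.\<close>
  define c where "c n j = (\<Sum>b\<in>Basis. (if b = h j then e \<bullet> b else (u n - axis_path h w j) \<bullet> b) *\<^sub>R b)" for n j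
  have c: "c n j \<bullet> b = (if b = h j then e \<bullet> b else (u n - axis_path h w j) \<bullet> b)" if "b \<in> Basis" for n j b
    using that by (simp add: c_def)
  define g where "g n j b = (if b = h j then \<rho> else D n)" for n j b
  have g0: "0 \<le> g n j b" for n j b using \<rho> D0 by (simp add: g_def)
  define B where "B n j = (if meets n then {a. \<forall>b\<in>Basis. \<bar>a \<bullet> b - c n j \<bullet> b\<bar> \<le> g n j b} else {})" for n j
  have Bsets: "B n j \<in> sets lborel" for n j
    unfolding B_def using emeasure_lborel_coordinate_box(1)[of "g n j" "c n j"] g0 by simp
  define wt where "wt n = (if meets n then hausdorff_weight N (U n) else 0)" for n
  have Bmeas: "emeasure lborel (B n j) = ennreal (2 ^ DIM('a) * \<rho>) * wt n" if j: "j < DIM('a)" for n j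
  proof (cases "meets n")
    case True
    have "(\<Prod>b\<in>Basis. 2 * g n j b) = (2 * g n j (h j)) * (\<Prod>b\<in>Basis - {h j}. 2 * g n j b)"
      using hB[OF j] by (intro prod.remove) auto
    also have "(\<Prod>b\<in>Basis - {h j}. 2 * g n j b) = (\<Prod>b\<in>Basis - {h j}. 2 * D n)"
      by (intro prod.cong) (auto simp: g_def)
    also have "\<dots> = (2 * D n) ^ N" using hB[OF j] by (simp add: N_def)
    finally have "(\<Prod>b\<in>Basis. 2 * g n j b) = (2 ^ DIM('a) * \<rho>) * D n ^ N"
      unfolding DN by (simp add: g_def power_mult_distrib)
    moreover have "U n \<noteq> {}" using True by (auto simp: meets_def)
    ultimately show ?thesis using True emeasure_lborel_coordinate_box(2)[of "g n j" "c n j"] g0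
        ennreal_mult[of "2 ^ DIM('a) * \<rho>" "D n ^ N"] D0[of n] \<rho>
      by (simp add: B_def wt_def hausdorff_weight_def flip: D_def)
  qed (simp add: B_def wt_def)
  have sub: "ball e \<rho> \<subseteq> (\<Union>n. \<Union>j<DIM('a). B n j)"
  proof
    fix a assume a: "a \<in> ball e \<rho>"
    then have "a + w \<in> ball (e + w) \<rho>" by (simp add: dist_norm)
    then obtain j t where j: "j < DIM('a)" and t: "t \<in> {0..1}"
      and z: "a + axis_path h w j + (t * (w \<bullet> h j)) *\<^sub>R h j \<in> parallel_boundary E r" (is "?z \<in> _")
      using axis_path_crossing[OF h inside[OF a] outside] by blast
    obtain n where n: "?z \<in> U n" using z cov by blast
    have "norm (?z - e) \<le> norm (axis_path h w j + (t * (w \<bullet> h j)) *\<^sub>R h j) + norm (a - e)"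
      by (rule order_trans[OF _ norm_triangle_ineq]) (simp add: algebra_simps)
    also have "\<dots> \<le> real DIM('a) * norm w + \<rho>"
      using a by (intro add_mono norm_axis_path_segment[OF h j t]) (simp add: dist_norm norm_minus_commute)
    finally have m: "meets n" using n by (auto simp: meets_def dist_norm norm_minus_commute)
    have "\<bar>a \<bullet> b - c n j \<bullet> b\<bar> \<le> g n j b" if b: "b \<in> Basis" for b
    proof (cases "b = h j")
      case True
      have "\<bar>(a - e) \<bullet> b\<bar> \<le> norm (a - e)" by (rule Basis_le_norm[OF b])
      also have "\<dots> \<le> \<rho>" using a by (simp add: dist_norm norm_minus_commute)
      finally show ?thesis using True b by (simp add: c g_def inner_diff_left)
    next
      case False
      have "\<bar>(?z - u n) \<bullet> b\<bar> \<le> norm (?z - u n)" by (rule Basis_le_norm[OF b])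
      also have "\<dots> \<le> D n"
        using diameter_bounded_bound[OF bU n u[OF m]] by (simp add: D_def dist_norm)
      finally have "\<bar>(?z - u n) \<bullet> b\<bar> \<le> D n" .
      \<comment> \<open>For \<open>b\<close> different from \<open>h j\<close> the unknown parameter
        \<open>t\<close> drops out.\<close>
      moreover have "(?z - u n) \<bullet> b = a \<bullet> b - c n j \<bullet> b"
        using False b hB[OF j] by (simp add: c inner_diff_left inner_add_left inner_not_same_Basis)
      ultimately show ?thesis using False by (simp add: g_def)
    qed
    then have "a \<in> B n j" using m by (simp add: B_def)
    then show "a \<in> (\<Union>n. \<Union>j<DIM('a). B n j)" using j by blast
  qed
  \<comment> \<open>One factor \<open>\<rho>\<close> is split off the volume of the ball, to be
    cancelled against the long side of the boxes.\<close>
  have "ennreal \<rho> * ennreal (v * \<rho> ^ N) = emeasure lborel (ball e \<rho>)"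
    using \<rho> v by (simp add: emeasure_ball v_def DN ennreal_mult[symmetric] mult_ac)
  also have "\<dots> \<le> emeasure lborel (\<Union>n. \<Union>j<DIM('a). B n j)"
    using sub Bsets by (intro emeasure_mono) auto
  also have "\<dots> \<le> (\<Sum>n. emeasure lborel (\<Union>j<DIM('a). B n j))"
    using Bsets by (intro emeasure_subadditive_countably) auto
  also have "\<dots> \<le> (\<Sum>n. \<Sum>j<DIM('a). emeasure lborel (B n j))"
    using Bsets by (intro suminf_le emeasure_subadditive_finite) auto
  also have "\<dots> = (\<Sum>n. ennreal \<rho> * (ennreal (real DIM('a) * 2 ^ DIM('a)) * wt n))"
    using \<rho> by (simp add: Bmeas ennreal_mult ennreal_of_nat_eq_real_of_nat mult_ac)
  also have "\<dots> = ennreal \<rho> * (ennreal (real DIM('a) * 2 ^ DIM('a)) * (\<Sum>n. wt n))"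
    by simp
  finally have "ennreal (v * \<rho> ^ N) \<le> ennreal (real DIM('a) * 2 ^ DIM('a)) * (\<Sum>n. wt n)"
    using \<rho> by (subst (asm) ennreal_mult_le_mult_iff) auto
  moreover have "wt = (\<lambda>n. if U n \<inter> cball e (real DIM('a) * norm w + \<rho>) = {} then 0
           else hausdorff_weight (DIM('a) - 1) (U n))"
    by (auto simp: wt_def meets_def N_def)
  ultimately show ?thesis by (simp add: v_def N_def)
qed

text \<open>Double counting of pairs of a ball and a covering set: the covering sets that meet the
  region \<open>T i\<close> of a ball have total weight at least a constant times
  \<open>t ^ N\<close>, while a set of diameter at most \<open>t\<close> meets at most
  \<open>M\<close> regions.\<close>

lemma card_le_hausdorff_measure_parallel_boundary:
  fixes E :: "'a::euclidean_space set" and x :: "'i \<Rightarrow> 'a"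
  assumes E: "compact E" "E \<noteq> {}" and t: "t > 0" and q: "t \<le> q" "q \<le> 2 * t"
    and J: "finite J" and C: "C \<ge> 1"
    and overlap: "\<And>y. (\<Sum>i\<in>J. indicator (cball (x i) (r i)) y :: ennreal) \<le> ennreal C"
    and xr: "\<And>i. i \<in> J \<Longrightarrow> infdist (x i) E = 8 * r i"
    and r: "\<And>i. i \<in> J \<Longrightarrow> t / 2 < r i \<and> r i \<le> t"
  shows "ennreal (unit_ball_vol DIM('a) / (real DIM('a) * 2 ^ DIM('a) * (C * (16 * real DIM('a) + 22) ^ DIM('a)))
      * real (card J) * t ^ (DIM('a) - 1))
    \<le> hausdorff_measure (DIM('a) - 1) (parallel_boundary E q)"
proof -
  define N where "N = DIM('a) - 1"
  define d where "d = real DIM('a)"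
  have d: "d \<ge> 1" by (simp add: d_def DIM_positive Suc_leI)
  define v where "v = unit_ball_vol d"
  have v: "v > 0" by (simp add: v_def d_def)
  \<comment> \<open>The packing count with \<open>R = 8 * d + 10\<close>, since
    \<open>2 * (R + 1) = 16 * d + 22\<close>.\<close>
  define M where "M = C * (16 * d + 22) ^ DIM('a)"
  have M: "M > 0" using C d by (simp add: M_def)
  define F where "F = d * 2 ^ DIM('a)"
  have F: "F > 0" using d by (simp add: F_def)
  have content: "ennreal (v * t ^ N * real (card J)) \<le> ennreal (F * M) * (\<Sum>n. hausdorff_weight N (U n))"
    if U: "\<And>n. bounded (U n)" "\<And>n. diameter (U n) \<le> t" "parallel_boundary E q \<subseteq> (\<Union>n. U n)"
    for U :: "nat \<Rightarrow> 'a set"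
  proof -
    have "\<exists>e\<in>E. infdist (x i) E = dist (x i) e" for i
      using infdist_attains_inf[OF compact_imp_closed[OF E(1)] E(2)] by metis
    then obtain e where e: "\<And>i. e i \<in> E" "\<And>i. infdist (x i) E = dist (x i) (e i)" by metis
    define T where "T i = cball (e i) (d * norm (x i - e i) + t)" for i
    have one: "ennreal (v * t ^ N) \<le> ennreal F *
        (\<Sum>n. if U n \<inter> T i = {} then 0 else hausdorff_weight N (U n))" if i: "i \<in> J" for i
    proof -
      have ins: "infdist a E < q" if "a \<in> ball (e i) t" for a
        using infdist_le[OF e(1), of a i] that q by (simp add: dist_commute)
      \<comment> \<open>The centre is at distance \<open>8 * r i > 4 * t\<close> from
        \<open>E\<close>, so its \<open>t\<close>-ball stays beyond \<open>3 * t\<close>, which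
        exceeds \<open>q \<le> 2 * t\<close>.\<close>
      have out: "q < infdist a E" if "a \<in> ball (e i + (x i - e i)) t" for a
      proof -
        have "infdist (x i) E \<le> infdist a E + dist (x i) a" by (rule infdist_triangle)
        then show ?thesis using that xr[OF i] r[OF i] q by simp
      qed
      show ?thesis
        using hausdorff_content_between_balls[where w = "x i - e i", OF t ins out U(1,3)]
        unfolding v_def F_def T_def N_def d_def .
    qed
    have many: "real (card {i \<in> J. U n \<inter> T i \<noteq> {}}) \<le> M" for n
    proof (cases "U n = {}")
      case False
      then obtain y where y: "y \<in> U n" by blast
      \<comment> \<open>The total consists of \<open>t\<close> across \<open>U n\<close>,
        \<open>8 * d * t + t\<close> for the radius of \<open>T i\<close>, and \<open>8 * t\<close>
        from \<open>e i\<close> to \<open>x i\<close>.\<close>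
      have "dist y (x i) \<le> (8 * d + 10) * t" if i: "i \<in> {i \<in> J. U n \<inter> T i \<noteq> {}}" for i
      proof -
        obtain z where z: "z \<in> U n" "z \<in> T i" using i by blast
        have ri: "norm (x i - e i) \<le> 8 * t" using i xr[of i] r[of i] e(2)[of i] by (simp add: dist_norm)
        have "dist y z \<le> t" using diameter_bounded_bound[OF U(1) y z(1)] U(2)[of n] by linarith
        moreover have "dist z (e i) \<le> d * (8 * t) + t"
        proof -
          have "dist z (e i) \<le> d * norm (x i - e i) + t" using z(2) by (simp add: T_def dist_commute)
          also have "\<dots> \<le> d * (8 * t) + t" using ri d by (intro add_right_mono mult_left_mono) auto
          finally show ?thesis .
        qed
        moreover have "dist (e i) (x i) \<le> 8 * t" using ri by (simp add: dist_norm norm_minus_commute)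
        ultimately show ?thesis
          using dist_triangle[of y "x i" z] dist_triangle[of z "x i" "e i"] by (simp add: algebra_simps)
      qed
      moreover have "(\<Sum>i\<in>{i \<in> J. U n \<inter> T i \<noteq> {}}. indicator (cball (x i) (r i)) y :: ennreal) \<le> ennreal C" for y
        by (rule order_trans[OF sum_mono2 overlap]) (use J in auto)
      ultimately have "real (card {i \<in> J. U n \<inter> T i \<noteq> {}}) \<le> C * (2 * ((8 * d + 10) + 1)) ^ DIM('a)"
        using J C t d r by (intro card_le_of_bounded_overlap[where t = t and x = x and r = r and y = y])
          (auto intro: less_imp_le)
      then show ?thesis by (simp add: M_def algebra_simps)
    qed (use M in simp)
    have "ennreal (v * t ^ N * real (card J)) = (\<Sum>i\<in>J. ennreal (v * t ^ N))"
      using v t by (simp add: ennreal_mult ennreal_of_nat_eq_real_of_nat mult.commute)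
    also have "\<dots> \<le> (\<Sum>i\<in>J. ennreal F * (\<Sum>n. if U n \<inter> T i = {} then 0 else hausdorff_weight N (U n)))"
      by (intro sum_mono one)
    also have "\<dots> = ennreal F * (\<Sum>i\<in>J. \<Sum>n. if U n \<inter> T i = {} then 0 else hausdorff_weight N (U n))"
      by (simp add: sum_distrib_left)
    also have "\<dots> = ennreal F * (\<Sum>n. \<Sum>i\<in>J. if U n \<inter> T i = {} then 0 else hausdorff_weight N (U n))"
      by (subst suminf_sum) auto
    also have "\<dots> \<le> ennreal F * (\<Sum>n. ennreal M * hausdorff_weight N (U n))"
    proof (intro mult_left_mono suminf_le)
      fix n
      have "(\<Sum>i\<in>J. if U n \<inter> T i = {} then 0 else hausdorff_weight N (U n))
          = (\<Sum>i\<in>{i \<in> J. U n \<inter> T i \<noteq> {}}. hausdorff_weight N (U n))"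
        using J by (intro sum.mono_neutral_cong_right) auto
      also have "\<dots> = ennreal (real (card {i \<in> J. U n \<inter> T i \<noteq> {}})) * hausdorff_weight N (U n)"
        by (simp add: ennreal_of_nat_eq_real_of_nat)
      also have "\<dots> \<le> ennreal M * hausdorff_weight N (U n)"
        using many by (intro mult_right_mono ennreal_leI) auto
      finally show "(\<Sum>i\<in>J. if U n \<inter> T i = {} then 0 else hausdorff_weight N (U n))
         \<le> ennreal M * hausdorff_weight N (U n)" .
    qed auto
    also have "\<dots> = ennreal (F * M) * (\<Sum>n. hausdorff_weight N (U n))"
      using F M by (simp add: ennreal_mult mult.assoc)
    finally show ?thesis .
  qed
  \<comment> \<open>The measure is a supremum over scales, so the single scale \<open>t\<close>
    suffices.\<close>
  have "ennreal (v / (F * M) * real (card J) * t ^ N) \<le> hausdorff_premeasure N t (parallel_boundary E q)"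
    unfolding hausdorff_premeasure_def
  proof (rule INF_greatest)
    fix U :: "nat \<Rightarrow> 'a set"
    assume "U \<in> {U. (\<forall>n. bounded (U n) \<and> diameter (U n) \<le> t) \<and> parallel_boundary E q \<subseteq> (\<Union>n. U n)}"
    then have "ennreal (v * t ^ N * real (card J)) \<le> ennreal (F * M) * (\<Sum>n. hausdorff_weight N (U n))"
      by (intro content) auto
    also have "v * t ^ N * real (card J) = (F * M) * (v / (F * M) * real (card J) * t ^ N)"
      using F M by simp
    also have "ennreal \<dots> = ennreal (F * M) * ennreal (v / (F * M) * real (card J) * t ^ N)"
      using F M v t by (intro ennreal_mult) auto
    finally show "ennreal (v / (F * M) * real (card J) * t ^ N) \<le> (\<Sum>n. hausdorff_weight N (U n))"
      using F M by (subst (asm) ennreal_mult_le_mult_iff) auto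
  qed
  also have "\<dots> \<le> hausdorff_measure N (parallel_boundary E q)"
    unfolding hausdorff_measure_def using t by (intro SUP_upper) auto
  finally show ?thesis by (simp add: v_def F_def M_def N_def d_def)
qed

section \<open>From estimates at dyadic scales to exponents\<close>

text \<open>Take the least \<open>k\<close> with \<open>1 / 2 ^ k \<le> q\<close>; minimality gives
  the upper bound, and for \<open>k = 0\<close> it follows from \<open>q < 1\<close>.\<close>

lemma dyadic_scale_exists:
  fixes q :: real
  assumes q: "0 < q" "q < 1 / 2 ^ k0"
  obtains k where "k \<ge> k0" "1 / 2 ^ k \<le> q" "q \<le> 2 / 2 ^ k"
proof -
  define P where "P k \<longleftrightarrow> 1 / 2 ^ k \<le> q" for k :: nat
  obtain k1 where "(1/2) ^ k1 < q" using real_arch_pow_inv[of q "1/2"] q by auto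
  then have ex: "P k1" by (simp add: P_def power_one_over)
  define k where "k = (LEAST k. P k)"
  have k: "P k" unfolding k_def using ex by (rule LeastI)
  have ge: "k \<ge> k0"
  proof (rule ccontr)
    assume "\<not> k \<ge> k0"
    then have "(1::real) / 2 ^ k0 \<le> 1 / 2 ^ k" by (intro divide_left_mono power_increasing) auto
    with q k show False by (simp add: P_def)
  qed
  have "q \<le> 2 / 2 ^ k"
  proof (cases k)
    case 0
    have "(1::real) / 2 ^ k0 \<le> 1" by simp
    with q(2) have "q < 1" by linarith
    with 0 show ?thesis by simp
  next
    case (Suc j)
    then have "\<not> P j" using not_less_Least[of j P] k_def by auto
    then show ?thesis using Suc by (simp add: P_def)
  qed
  with ge k show ?thesis using that by (simp add: P_def)
qed

lemma one_over_two_power_eq_powr: "(1::real) / 2 ^ k = 2 powr (- real k)"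
  by (simp add: powr_minus powr_realpow divide_inverse)

lemma eventually_mult_power_less:
  fixes X \<theta> \<eta> :: real
  assumes "0 \<le> \<theta>" "\<theta> < 1" "\<eta> > 0"
  shows "eventually (\<lambda>k. X * \<theta> ^ k < \<eta>) sequentially"
proof -
  have "(\<lambda>k. X * \<theta> ^ k) \<longlonglongrightarrow> 0"
    using assms by (intro tendsto_mult_right_zero LIMSEQ_power_zero) auto
  then show ?thesis using assms(3) by (rule order_tendstoD)
qed

text \<open>A vanishing lower limit only needs small values along a sequence, so
  \<open>upper\<close> at the radii \<open>5 / 2 ^ k\<close> is enough for one inequality. The other
  needs a positive bound at every small radius, hence \<open>lower\<close> on whole dyadic
  intervals.\<close>

lemma inf_exponent_eq_liminf_log:
  fixes S :: "real \<Rightarrow> ennreal" and N :: "nat \<Rightarrow> nat" and n :: nat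
  assumes C: "C > 0" and upper: "\<And>k. S (5 / 2 ^ k) \<le> ennreal (C * real (N k) * (1 / 2 ^ k) ^ n)"
    and c: "c > 0" and lower: "\<And>k q. 1 / 2 ^ k \<le> q \<Longrightarrow> q \<le> 2 / 2 ^ k \<Longrightarrow>
        ennreal (c * real (N k) * (1 / 2 ^ k) ^ n) \<le> S q"
  shows "Inf (ereal ` {s. 0 \<le> s \<and> Liminf (at_right 0) (\<lambda>q. S q / ennreal (q powr (real n - s))) = 0})
    = liminf (\<lambda>k. ereal (1 / real k * log 2 (real (N k))))"
    (is "Inf (ereal ` ?A) = liminf ?x")
proof (rule antisym)
  \<comment> \<open>Here \<open>log 2 0 = 0\<close>, so an empty level contributes 0; the term for
    \<open>k = 0\<close> is 0 because \<open>1 / 0 = 0\<close>.\<close>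
  have x0: "0 \<le> ?x k" for k by (cases "N k = 0") (auto simp: log_def)
  have L0: "0 \<le> liminf ?x" by (intro Liminf_bounded always_eventually allI x0)
  have pw: "(1 / 2 ^ k) ^ n = 2 powr (- real k * real n)" for k :: nat
    unfolding one_over_two_power_eq_powr by (simp add: powr_power mult.commute)
  have mem: "s \<in> ?A" if s: "liminf ?x < ereal s" for s
  proof -
    \<comment> \<open>The gap between \<open>s'\<close> and \<open>s\<close> produces the decaying
      factor \<open>2 powr (real k * (s' - s))\<close>.\<close>
    obtain s' where s': "liminf ?x < ereal s'" "s' < s"
      using ereal_dense2[OF s] by auto
    have "Liminf (at_right 0) (\<lambda>q. S q / ennreal (q powr (real n - s))) = 0"
    proof (rule ccontr)
      assume "\<not> ?thesis"
      then obtain y where y: "0 < y" "y < Liminf (at_right 0) (\<lambda>q. S q / ennreal (q powr (real n - s)))"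
        using dense[of 0 "Liminf (at_right 0) (\<lambda>q. S q / ennreal (q powr (real n - s)))"]
        by (auto simp: zero_less_iff_neq_zero)
      then have "y < top" by (meson less_le_trans top_greatest)
      then obtain \<eta> where \<eta>: "y = ennreal \<eta>" "\<eta> > 0" using y(1) by (cases y) auto
      obtain b where b: "b > 0"
        "\<And>q. 0 < q \<Longrightarrow> q < b \<Longrightarrow> y < S q / ennreal (q powr (real n - s))"
        using less_LiminfD[OF y(2)] by (auto simp: eventually_at_right_field)
      \<comment> \<open>\<open>C\<close> together with the power of 5 that the radius
        \<open>5 / 2 ^ k\<close> leaves in the quotient.\<close>
      define B where "B = C * 5 powr (s - real n)"
      have "eventually (\<lambda>k::nat. 5 / 2 ^ k < b) sequentially"
        using eventually_mult_power_less[of "1/2" b 5] b(1) by (simp add: power_one_over)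
      moreover have "eventually (\<lambda>k::nat. B * 2 powr (real k * (s' - s)) < \<eta>) sequentially"
        using eventually_mult_power_less[of "2 powr (s' - s)" \<eta> B] \<eta>(2) s'(2)
        by (simp add: powr_power powr_less_one mult.commute)
      ultimately have small: "eventually (\<lambda>k::nat. 5 / 2 ^ k < b \<and> B * 2 powr (real k * (s' - s)) < \<eta>) sequentially"
        by (rule eventually_conj)
      have "\<not> eventually (\<lambda>k. ereal s' \<le> ?x k) sequentially"
        using s'(1) Liminf_bounded by (metis not_le)
      then have "frequently (\<lambda>k. ?x k < ereal s') sequentially"
        unfolding frequently_def not_less .
      then have "frequently (\<lambda>k. ?x k < ereal s' \<and> 0 < k \<and> 5 / 2 ^ k < b \<and>
           B * 2 powr (real k * (s' - s)) < \<eta>) sequentially"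
        by (rule frequently_eventually_frequently)
          (rule eventually_conj[OF eventually_gt_at_top small])
      then obtain k where k: "?x k < ereal s'" "0 < k" "5 / 2 ^ k < b"
         "B * 2 powr (real k * (s' - s)) < \<eta>" by (auto dest!: frequently_ex)
      have Nk: "real (N k) \<le> 2 powr (real k * s')"
      proof (cases "N k = 0")
        case False
        have "log 2 (real (N k)) < real k * s'" using k(1,2) by (simp add: field_simps)
        then show ?thesis using False by (simp add: log_less_iff less_imp_le)
      qed simp
      define q where "q = 5 / (2::real) ^ k"
      have q0: "q > 0" by (simp add: q_def)
      have qp: "q powr (real n - s) = 5 powr (real n - s) * 2 powr (- real k * (real n - s))"
        unfolding q_def using one_over_two_power_eq_powr[of k]
        by (metis (no_types, opaque_lifting) powr_mult powr_powr mult.right_neutral times_divide_eq_right)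
      have "S q / ennreal (q powr (real n - s))
          \<le> ennreal (C * real (N k) * (1 / 2 ^ k) ^ n) / ennreal (q powr (real n - s))"
        unfolding q_def by (intro divide_right_mono_ennreal upper)
      also have "\<dots> = ennreal (C * real (N k) * (1 / 2 ^ k) ^ n / q powr (real n - s))"
        using C q0 by (intro divide_ennreal) auto
      also have "C * real (N k) * (1 / 2 ^ k) ^ n / q powr (real n - s)
          = B * real (N k) * 2 powr (- real k * s)"
        unfolding qp pw B_def by (simp add: powr_diff powr_add powr_minus field_simps flip: powr_add)
      also have "\<dots> \<le> B * 2 powr (real k * s') * 2 powr (- real k * s)"
        using Nk C by (intro mult_right_mono mult_left_mono) (auto simp: B_def)
      also have "\<dots> = B * 2 powr (real k * (s' - s))"
        by (simp add: algebra_simps flip: powr_add)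
      finally have "S q / ennreal (q powr (real n - s)) < y"
        using k(4) C by (simp add: \<eta> ennreal_leI ennreal_lessI order_le_less_trans)
      with b(2)[OF q0] k(3) show False by (simp add: q_def)
    qed
    moreover have "0 \<le> s" using L0 s by (metis ereal_less_eq(5) less_imp_le order_trans)
    ultimately show ?thesis by simp
  qed
  show "Inf (ereal ` ?A) \<le> liminf ?x"
  proof (rule dense_ge)
    fix z assume z: "liminf ?x < z"
    then show "Inf (ereal ` ?A) \<le> z"
    proof -
      obtain s where "liminf ?x < ereal s" "ereal s < z" using ereal_dense2[OF z] by auto
      then show ?thesis using mem[of s] by (meson Inf_lower imageI less_imp_le order_trans)
    qed
  qed
  show "liminf ?x \<le> Inf (ereal ` ?A)"
  proof (rule Inf_greatest, clarify)
    fix s assume s: "0 \<le> s" and lim: "Liminf (at_right 0) (\<lambda>q. S q / ennreal (q powr (real n - s))) = 0"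
    show "liminf ?x \<le> ereal s"
    proof (rule ccontr)
      assume "\<not> ?thesis"
      then have "eventually (\<lambda>k. ereal s < ?x k) sequentially"
        by (intro less_LiminfD) simp
      then obtain k1 where k1: "\<And>k. k \<ge> k1 \<Longrightarrow> ereal s < ?x k" by (auto simp: eventually_sequentially)
      \<comment> \<open>The maximum with 1 excludes \<open>k = 0\<close>, where multiplying by
        \<open>k\<close> would not undo the division.\<close>
      define k0 where "k0 = max k1 1"
      define a where "a = real n - s"
      \<comment> \<open>The factor \<open>2 powr \<bar>a\<bar>\<close> bounds the variation of
        \<open>q powr a\<close> over a dyadic interval for either sign of \<open>a\<close>.\<close>
      define \<gamma> where "\<gamma> = c / 2 powr \<bar>a\<bar>"
      have "\<gamma> > 0" using c by (simp add: \<gamma>_def)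
      have "ennreal \<gamma> \<le> S q / ennreal (q powr a)" if q: "0 < q" "q < 1 / 2 ^ k0" for q
      proof -
        obtain k where k: "k \<ge> k0" "1 / 2 ^ k \<le> q" "q \<le> 2 / 2 ^ k"
          using dyadic_scale_exists[OF q] .
        have kp: "k > 0" "k \<ge> k1" using k(1) by (auto simp: k0_def)
        have lg: "real k * s < log 2 (real (N k))" using k1[OF kp(2)] kp by (simp add: field_simps)
        \<comment> \<open>Forces the logarithm to be positive, which rules out
          \<open>N k = 0\<close> with its default value 0.\<close>
        have "0 \<le> real k * s" using s by simp
        with lg have "N k \<noteq> 0" by (cases "N k = 0") (auto simp: log_def)
        then have Nk: "2 powr (real k * s) \<le> real (N k)"
          using lg by (simp add: less_log_iff less_imp_le)
        have qa: "q powr a \<le> 2 powr (- real k * a) * 2 powr \<bar>a\<bar>"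
        proof (cases "a \<ge> 0")
          case True
          have "q powr a \<le> (2 / 2 ^ k) powr a" using k True q by (intro powr_mono2) auto
          also have "2 / 2 ^ k = (2 powr (1 - real k) :: real)"
            by (simp add: powr_diff powr_realpow)
          finally show ?thesis using True by (simp add: powr_powr algebra_simps flip: powr_add)
        next
          case False
          have "q powr a \<le> (1 / 2 ^ k) powr a" using k False q by (intro powr_mono2') auto
          also have "\<dots> = 2 powr (- real k * a) * 1"
            by (simp add: one_over_two_power_eq_powr powr_powr)
          also have "\<dots> \<le> 2 powr (- real k * a) * 2 powr \<bar>a\<bar>"
            by (intro mult_left_mono ge_one_powr_ge_zero) auto
          finally show ?thesis .
        qed
        have "\<gamma> * q powr a \<le> \<gamma> * (2 powr (- real k * a) * 2 powr \<bar>a\<bar>)"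
          using qa \<open>\<gamma> > 0\<close> by simp
        also have "\<dots> = c * 2 powr (- real k * a)" by (simp add: \<gamma>_def)
        also have "\<dots> = c * 2 powr (real k * s) * 2 powr (- real k * real n)"
          by (simp add: a_def algebra_simps flip: powr_add)
        also have "\<dots> \<le> c * real (N k) * (1 / 2 ^ k) ^ n"
          unfolding pw using Nk c by (intro mult_right_mono mult_left_mono) auto
        finally have le: "\<gamma> \<le> c * real (N k) * (1 / 2 ^ k) ^ n / q powr a"
          using q by (simp add: field_simps)
        have "ennreal (c * real (N k) * (1 / 2 ^ k) ^ n / q powr a)
            = ennreal (c * real (N k) * (1 / 2 ^ k) ^ n) / ennreal (q powr a)"
          using c q by (intro divide_ennreal[symmetric]) auto
        also have "\<dots> \<le> S q / ennreal (q powr a)"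
          using lower[OF k(2,3)] by (rule divide_right_mono_ennreal)
        finally show ?thesis using ennreal_leI[OF le] by (rule order_trans[rotated])
      qed
      then have "eventually (\<lambda>q. ennreal \<gamma> \<le> S q / ennreal (q powr a)) (at_right 0)"
        by (auto simp: eventually_at_right_field intro!: exI[of _ "1 / 2 ^ k0"])
      then have "ennreal \<gamma> \<le> 0" using Liminf_bounded lim unfolding a_def by metis
      with \<open>\<gamma> > 0\<close> show False by simp
    qed
  qed
qed

section \<open>Finite levels of a Whitney cover and the dimension formula\<close>

text \<open>An infinite \<open>A\<close> would have finite subsets of every size, against the
  packing count around the origin. Finiteness matters because \<open>card\<close> is 0 on infinite
  sets.\<close>

lemma finite_of_bounded_overlap:
  fixes x :: "'i \<Rightarrow> 'a::euclidean_space"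
  assumes "bounded (x ` A)" and C: "C \<ge> 0" and t: "t > 0"
    and overlap: "\<And>J y. finite J \<Longrightarrow> J \<subseteq> A \<Longrightarrow>
      (\<Sum>i\<in>J. indicator (cball (x i) (r i)) y :: ennreal) \<le> ennreal C"
    and r: "\<And>i. i \<in> A \<Longrightarrow> t / 2 \<le> r i \<and> r i \<le> t"
  shows "finite A"
proof (rule ccontr)
  assume inf: "infinite A"
  obtain R where R: "\<And>i. i \<in> A \<Longrightarrow> norm (x i) \<le> R"
    using assms(1) by (auto simp: bounded_iff)
  define R' where "R' = \<bar>R\<bar> / t"
  obtain m :: nat where m: "C * (2 * (R' + 1)) ^ DIM('a) < real m"
    using reals_Archimedean2 by blast
  obtain J where J: "J \<subseteq> A" "finite J" "card J = m"
    using infinite_arbitrarily_large[OF inf] by blast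
  have "real (card J) \<le> C * (2 * (R' + 1)) ^ DIM('a)"
  proof (rule card_le_of_bounded_overlap[OF J(2) C t _ overlap[OF J(2,1)]])
    show "0 \<le> R'" using t by (simp add: R'_def)
    show "t / 2 \<le> r i \<and> r i \<le> t" if "i \<in> J" for i
      using r that J(1) by blast
    show "dist 0 (x i) \<le> R' * t" if "i \<in> J" for i
      using R[of i] that J(1) t by (auto simp: R'_def)
  qed
  with m J show False by simp
qed

theorem theorem5p1:
  fixes E :: "'a::euclidean_space set"
    and I :: "'i set" and x :: "'i \<Rightarrow> 'a" and r :: "'i \<Rightarrow> real"
  assumes "compact E" and "E \<noteq> {}"
    and "whitney_cover (- E) I x r"
  shows "lower_spherical_dim E =
    liminf (\<lambda>k::nat. ereal (1 / real k * log 2 (real (card (whitney_level I x r (int k))))))"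
proof -
  define n where "n = DIM('a) - 1"
  have n: "real DIM('a) - 1 = real n" by (simp add: n_def of_nat_diff DIM_positive Suc_leI)
  have rad: "\<forall>i\<in>I. x i \<in> - E \<and> r i = infdist (x i) (- (- E)) / 8"
    and cov: "- E = (\<Union>i\<in>I. cball (x i) (r i))"
    and ov: "\<exists>C\<ge>1. \<forall>y. (\<Sum>\<^sub>\<infinity>i\<in>I. indicator (cball (x i) (r i)) y :: ennreal) \<le> ennreal C"
    using assms(3) unfolding whitney_cover_def by - (elim conjE, assumption)+
  have xr: "infdist (x i) E = 8 * r i" if "i \<in> I" for i
  proof -
    have "r i = infdist (x i) E / 8" using rad that by (metis double_complement)
    then show ?thesis by linarith
  qed
  obtain C :: real where C: "C \<ge> 1"
    "\<And>y. (\<Sum>\<^sub>\<infinity>i\<in>I. indicator (cball (x i) (r i)) y :: ennreal) \<le> ennreal C"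
    using ov by blast
  have overlap: "(\<Sum>i\<in>J. indicator (cball (x i) (r i)) y :: ennreal) \<le> ennreal C"
    if "finite J" "J \<subseteq> I" for J y
  proof -
    have "(\<Sum>i\<in>J. indicator (cball (x i) (r i)) y :: ennreal)
        = (\<Sum>\<^sub>\<infinity>i\<in>J. indicator (cball (x i) (r i)) y)" using that by simp
    also have "\<dots> \<le> (\<Sum>\<^sub>\<infinity>i\<in>I. indicator (cball (x i) (r i)) y)"
      using that by (intro infsum_mono_neutral nonneg_summable_on_complete) auto
    finally show ?thesis using C(2) order_trans by blast
  qed
  \<comment> \<open>Indices rather than balls: distinct indices may give the same ball, so a level
    is the image of \<open>A k\<close> and may have fewer elements.\<close>
  define A where "A k = {i \<in> I. 1 / 2 ^ k / 2 < r i \<and> r i \<le> 1 / 2 ^ k}" for k :: nat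
  have level: "whitney_level I x r (int k) = (\<lambda>i. cball (x i) (r i)) ` A k" for k
  proof -
    have pow: "(2::real) powi (- int k) = 1 / 2 ^ k"
      by (simp add: power_int_minus inverse_eq_divide)
    moreover have "(2::real) powi (- int k - 1) = 1 / 2 ^ k / 2"
      by (subst power_int_diff) (simp_all add: pow)
    ultimately show ?thesis by (auto simp: whitney_level_def A_def)
  qed
  obtain R where R: "\<And>e. e \<in> E \<Longrightarrow> norm e \<le> R"
    using compact_imp_bounded[OF assms(1)] by (auto simp: bounded_iff)
  have finA: "finite (A k)" for k
  proof (rule finite_of_bounded_overlap)
    show "bounded (x ` A k)"
      unfolding bounded_iff
    proof (intro exI[of _ "R + 8 * (1 / 2 ^ k)"] ballI)
      fix y assume "y \<in> x ` A k"
      then obtain i where i: "i \<in> I" "r i \<le> 1 / 2 ^ k" "y = x i" by (auto simp: A_def)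
      obtain e where e: "e \<in> E" "infdist y E = dist y e"
        using infdist_attains_inf[OF compact_imp_closed[OF assms(1)] assms(2)] by metis
      have "norm y \<le> norm e + norm (y - e)"
        using norm_triangle_ineq[of e "y - e"] by simp
      then show "norm y \<le> R + 8 * (1 / 2 ^ k)"
        using R[OF e(1)] e(2) xr[OF i(1)] i by (simp add: dist_norm)
    qed
    show "(\<Sum>i\<in>J. indicator (cball (x i) (r i)) y :: ennreal) \<le> ennreal C"
      if "finite J" "J \<subseteq> A k" for J y using that by (intro overlap) (auto simp: A_def)
    show "1 / 2 ^ k / 2 \<le> r i \<and> r i \<le> 1 / 2 ^ k" if "i \<in> A k" for i
      using that by (auto simp: A_def)
  qed (use C in auto)
  obtain K where K: "K > 0"
    "\<And>(E :: 'a set) r P. compact E \<Longrightarrow> E \<noteq> {} \<Longrightarrow> r > 0 \<Longrightarrow> finite P \<Longrightarrow>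
       parallel_boundary E r \<subseteq> (\<Union>p\<in>P. cball p r) \<Longrightarrow>
       hausdorff_measure n (parallel_boundary E r) \<le> ennreal (K * real (card P) * r ^ n)"
    unfolding n_def using hausdorff_measure_parallel_boundary_le[where 'a = 'a] by blast
  have upper: "hausdorff_measure n (parallel_boundary E (5 / 2 ^ k)) \<le>
      ennreal ((K * 5 ^ n) * real (card (whitney_level I x r (int k))) * (1 / 2 ^ k) ^ n)" for k
  proof -
    \<comment> \<open>One index per ball, so that the number of indices equals the cardinality of
      the level.\<close>
    obtain U where U: "U \<subseteq> A k" "inj_on (\<lambda>i. cball (x i) (r i)) U"
      "whitney_level I x r (int k) = (\<lambda>i. cball (x i) (r i)) ` U"
      using subset_image_inj[THEN iffD1, OF equalityD1[OF level]] by blast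
    have finU: "finite U" using U(1) finA finite_subset by blast
    have "parallel_boundary E (5 / 2 ^ k) \<subseteq> (\<Union>p\<in>x ` U. cball p (5 / 2 ^ k))"
    proof
      fix y assume "y \<in> parallel_boundary E (5 / 2 ^ k)"
      then have y: "infdist y E = 5 / 2 ^ k" by (simp add: parallel_boundary_def)
      then have "y \<in> - E" by auto
      then obtain i where i: "i \<in> I" "dist (x i) y \<le> r i" unfolding cov by auto
      define t where "t = 1 / (2::real) ^ k"
      \<comment> \<open>This explains the 5: a ball meeting the \<open>5 * t\<close>-boundary has
        radius between \<open>5 * t / 9\<close> and \<open>5 * t / 7\<close>, hence belongs to level
        \<open>k\<close>.\<close>
      have "7 * r i \<le> 5 * t" "5 * t \<le> 9 * r i"
        using infdist_triangle[of "x i" E y] infdist_triangle[of y E "x i"] xr[OF i(1)] i(2) y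
        by (auto simp: dist_commute t_def)
      moreover have "0 < t" by (simp add: t_def)
      ultimately have "t / 2 < r i" "r i \<le> t" by linarith+
      then have "cball (x i) (r i) \<in> whitney_level I x r (int k)" using i level by (auto simp: A_def t_def)
      \<comment> \<open>The chosen index \<open>j\<close> may differ from \<open>i\<close>; equality
        of the balls as sets carries membership of \<open>y\<close> over.\<close>
      then obtain j where j: "j \<in> U" "cball (x j) (r j) = cball (x i) (r i)" using U(3) by auto
      then have "dist (x j) y \<le> r j" using i(2) by (metis mem_cball)
      moreover have "r j \<le> 1 / 2 ^ k" using j U(1) by (auto simp: A_def)
      moreover have "1 / 2 ^ k \<le> (5::real) / 2 ^ k" by (simp add: divide_right_mono)
      ultimately show "y \<in> (\<Union>p\<in>x ` U. cball p (5 / 2 ^ k))" using j(1) by force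
    qed
    then have "hausdorff_measure n (parallel_boundary E (5 / 2 ^ k))
        \<le> ennreal (K * real (card (x ` U)) * (5 / 2 ^ k) ^ n)"
      using finU assms by (intro K(2)) auto
    also have "\<dots> \<le> ennreal (K * real (card U) * (5 / 2 ^ k) ^ n)"
      using card_image_le[OF finU, of x] K(1) by (intro ennreal_leI mult_right_mono mult_left_mono) auto
    also have "card U = card (whitney_level I x r (int k))" using U by (simp add: card_image)
    also have "K * real (card (whitney_level I x r (int k))) * (5 / 2 ^ k) ^ n
        = (K * 5 ^ n) * real (card (whitney_level I x r (int k))) * (1 / 2 ^ k) ^ n"
      by (simp add: power_divide)
    finally show ?thesis .
  qed
  define c where "c = unit_ball_vol DIM('a) / (real DIM('a) * 2 ^ DIM('a) * (C * (16 * real DIM('a) + 22) ^ DIM('a)))"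
  have c: "c > 0" unfolding c_def using C by (intro divide_pos_pos mult_pos_pos zero_less_power) (auto intro: add_nonneg_pos)
  have lower: "ennreal (c * real (card (whitney_level I x r (int k))) * (1 / 2 ^ k) ^ n)
      \<le> hausdorff_measure n (parallel_boundary E q)" if q: "1 / 2 ^ k \<le> q" "q \<le> 2 / 2 ^ k" for k q
  proof -
    \<comment> \<open>In this direction repeated indices are harmless, as they only enlarge the
      count that is bounded.\<close>
    have "card (whitney_level I x r (int k)) \<le> card (A k)"
      unfolding level by (rule card_image_le[OF finA])
    then have "ennreal (c * real (card (whitney_level I x r (int k))) * (1 / 2 ^ k) ^ n)
        \<le> ennreal (c * real (card (A k)) * (1 / 2 ^ k) ^ n)"
      using c by (intro ennreal_leI mult_right_mono mult_left_mono) auto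
    also have "\<dots> \<le> hausdorff_measure n (parallel_boundary E q)"
      unfolding c_def n_def
    proof (rule card_le_hausdorff_measure_parallel_boundary[OF assms(1,2) _ q(1) _ finA C(1)])
      show "(\<Sum>i\<in>A k. indicator (cball (x i) (r i)) y :: ennreal) \<le> ennreal C" for y
        using finA by (intro overlap) (auto simp: A_def)
    qed (use q(2) xr in \<open>auto simp: A_def\<close>)
    finally show ?thesis .
  qed
  show ?thesis
    unfolding lower_spherical_dim_def n n_def[symmetric]
    using K(1) by (intro inf_exponent_eq_liminf_log[OF _ upper c lower]) auto
qed

end
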